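(* Let $\alpha,\beta$ be compositions with $\beta\subseteq\alpha$. Then the poset $P\mathcal{R}\mathfrak{S}^*_{\alpha/\beta}$ is graded, and the rank of the skew standard immaculate tableau $T$ is given by $\mathrm{inv}(T)-\mathrm{inv}(S^0_{\alpha/\beta})$. In particular, $\mathrm{inv}(S^{row}_{\alpha/\beta})=\binom{|\alpha|-|\beta|}{2}$, and $$\mathrm{inv}(S^0_{\alpha/\beta})=\sum_{i=1}^{\ell(\beta)}\binom{\alpha_i-\beta_i}{2}+\sum_{i=\ell(\beta)+1}^{\ell(\alpha)}\binom{\alpha_i+i-\ell(\beta)-1}{2}-\binom{\ell(\alpha)-\ell(\beta)}{3}.$$ Hence the rank of the poset $P\mathcal{R}\mathfrak{S}^*_{\alpha/\beta}$ is $$\binom{|\alpha|-|\beta|}{2}-\sum_{i=1}^{\ell(\beta)}\binom{\alpha_i-\beta_i}{2}-\sum_{i=\ell(\beta)+1}^{\ell(\alpha)}\binom{\alpha_i+i-\ell(\beta)-1}{2}+\binom{\ell(\alpha)-\ell(\beta)}{3}.$$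
   Context: Compositions and tableaux. A composition $\alpha=(\alpha_1,\dots,\alpha_k)\vDash n$ is a finite sequence of positive integers with sum $n=|\alpha|$; $\ell(\alpha)=k$; $\emptyset$ is the empty composition of $0$. The diagram of $\alpha$ is the left-justified array of cells with $\alpha_i$ cells in row $i$, rows numbered from bottom to top. $\beta\subseteq\alpha$ means $\ell(\beta)\le\ell(\alpha)$ and $\beta_j\le\alpha_j$ for all $1\le j\le \ell(\beta)$; the skew diagram $\alpha/\beta$ is the set of cells of the diagram of $\alpha$ not in that of $\beta$, where $\beta$ is placed in the bottom-left corner of $\alpha$. $\mathrm{SIT}(\alpha/\beta)$ (the skew standard immaculate tableaux) is the set of bijective fillings of the cells of $\alpha/\beta$ with $1,\dots,|\alpha|-|\beta|$ such that the entries in the cells of the leftmost column of $\alpha$ that are not in $\beta$ increase from bottom to top, and all rows increase from left to right. $S^0_{\alpha/\beta}$: the cells of the first column of $\alpha$ remaining in $\alpha/\beta$ (if any) are filled with $1,\dots,\ell(\alpha)-\ell(\beta)$, increasing bottom to top, and then the remaining cells are filled by rows, top to bottom, left to right within rows, with the consecutive integers $\ell(\alpha)-\ell(\beta)+1,\dots,|\alpha|-|\beta|$. $S^{row}_{\alpha/\beta}$: rows are filled left to right, bottom to top, with $1,2,\dots,|\alpha|-|\beta|$ in consecutive order. Action ($\mathcal{R}\mathfrak{S}^*$-action). For $1\le i\le |\alpha|-|\beta|-1$ and $T\in\mathrm{SIT}(\alpha/\beta)$: $\pi_i(T)=T$ if $i+1$ is in a row strictly above $i$; $\pi_i(T)=s_i(T)$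 (switch $i$ and $i+1$) if $i+1$ is in a row strictly below $i$; $\pi_i(T)=0$ if $i,i+1$ are in the same row. The skew immaculate Hecke poset $P\mathcal{R}\mathfrak{S}^*_{\alpha/\beta}$ is $\mathrm{SIT}(\alpha/\beta)$ with the partial order whose cover relations are $S\prec T$ iff $S\ne T$ and $T=\pi_i(S)$ for some $i$. Inversions. The reading word $\mathrm{rw}(T)$ consists of the entries of $T$ read from right to left along rows, from the top row to the bottom row. $\mathrm{inv}(T)$ is the number of inversions of the word $\mathrm{rw}(T)$, i.e. the number of pairs of positions $p<q$ such that the $p$-th letter is larger than the $q$-th letter. *)

theory Defs
  imports Complex_Main "HOL-Library.FuncSet" "HOL-Combinatorics.Transposition"
begin

section \<open>Graded posets\<close>

text \<open>A poset is a carrier \<open>A\<close> with a relation \<open>r \<subseteq> A \<times> A\<close> satisfying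
  \<open>partial_order_on A r\<close>; then every member of \<open>Chains r\<close> is a subset of \<open>A\<close>.\<close>

definition maximal_chains :: "('a \<times> 'a) set \<Rightarrow> 'a set set" where
  "maximal_chains r = {M \<in> Chains r. \<forall>C \<in> Chains r. M \<subseteq> C \<longrightarrow> C = M}"

text \<open>A chain with \<open>n + 1\<close> elements has length \<open>n\<close>.\<close>

definition max_chains_have_length :: "('a \<times> 'a) set \<Rightarrow> nat \<Rightarrow> bool" where
  "max_chains_have_length r n \<longleftrightarrow> (\<forall>M \<in> maximal_chains r. finite M \<and> card M = n + 1)"

definition graded_poset :: "'a set \<Rightarrow> ('a \<times> 'a) set \<Rightarrow> bool" where
  "graded_poset A r \<longleftrightarrow> partial_order_on A r \<and> (\<exists>n. max_chains_have_length r n)"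

definition poset_rank :: "('a \<times> 'a) set \<Rightarrow> nat" where
  "poset_rank r = (THE n. max_chains_have_length r n)"

definition covered_by :: "('a \<times> 'a) set \<Rightarrow> 'a \<Rightarrow> 'a \<Rightarrow> bool" where
  "covered_by r x y \<longleftrightarrow>
     (x, y) \<in> r \<and> x \<noteq> y \<and> (\<forall>z. (x, z) \<in> r \<and> (z, y) \<in> r \<longrightarrow> z = x \<or> z = y)"

text \<open>In a graded poset these two conditions determine \<open>\<rho>\<close> uniquely on \<open>A\<close>. The values are
  integers only so that differences can be written without truncation.\<close>

definition is_rank_function :: "'a set \<Rightarrow> ('a \<times> 'a) set \<Rightarrow> ('a \<Rightarrow> int) \<Rightarrow> bool" where
  "is_rank_function A r \<rho> \<longleftrightarrow>
     (\<forall>x \<in> A. (\<forall>y. (y, x) \<in> r \<longrightarrow> y = x) \<longrightarrow> \<rho> x = 0) \<and>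
     (\<forall>x \<in> A. \<forall>y \<in> A. covered_by r x y \<longrightarrow> \<rho> y = \<rho> x + 1)"

section \<open>Compositions and skew diagrams\<close>

definition composition :: "nat list \<Rightarrow> bool" where
  "composition \<alpha> \<longleftrightarrow> (\<forall>a \<in> set \<alpha>. 0 < a)"

text \<open>Parts are numbered from \<open>1\<close>, and all parts beyond the length are \<open>0\<close>.\<close>

definition part :: "nat list \<Rightarrow> nat \<Rightarrow> nat" where
  "part \<alpha> i = (if 1 \<le> i \<and> i \<le> length \<alpha> then \<alpha> ! (i - 1) else 0)"

definition comp_subset :: "nat list \<Rightarrow> nat list \<Rightarrow> bool" where
  "comp_subset \<beta> \<alpha> \<longleftrightarrow>
     length \<beta> \<le> length \<alpha> \<and> (\<forall>j \<in> {1..length \<beta>}. part \<beta> j \<le> part \<alpha> j)"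

text \<open>Cells are pairs (row, column), with rows numbered from bottom to top and columns from
  left to right, both starting at \<open>1\<close>.\<close>

definition diagram :: "nat list \<Rightarrow> (nat \<times> nat) set" where
  "diagram \<alpha> = {(i, j). 1 \<le> i \<and> i \<le> length \<alpha> \<and> 1 \<le> j \<and> j \<le> part \<alpha> i}"

definition skew_diagram :: "nat list \<Rightarrow> nat list \<Rightarrow> (nat \<times> nat) set" where
  "skew_diagram \<alpha> \<beta> = diagram \<alpha> - diagram \<beta>"

definition skew_size :: "nat list \<Rightarrow> nat list \<Rightarrow> nat" where
  "skew_size \<alpha> \<beta> = sum_list \<alpha> - sum_list \<beta>"

definition skew_row :: "nat list \<Rightarrow> nat list \<Rightarrow> nat \<Rightarrow> (nat \<times> nat) list" where
  "skew_row \<alpha> \<beta> i = map (\<lambda>j. (i, j)) [part \<beta> i + 1 ..< part \<alpha> i + 1]"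

section \<open>Skew standard immaculate tableaux\<close>

type_synonym tableau = "nat \<times> nat \<Rightarrow> nat"

definition SIT :: "nat list \<Rightarrow> nat list \<Rightarrow> tableau set" where
  "SIT \<alpha> \<beta> = {T \<in> extensional (skew_diagram \<alpha> \<beta>).
     bij_betw T (skew_diagram \<alpha> \<beta>) {1..skew_size \<alpha> \<beta>} \<and>
     (\<forall>i i'. (i, 1) \<in> skew_diagram \<alpha> \<beta> \<and> (i', 1) \<in> skew_diagram \<alpha> \<beta> \<and> i < i'
        \<longrightarrow> T (i, 1) < T (i', 1)) \<and>
     (\<forall>i j j'. (i, j) \<in> skew_diagram \<alpha> \<beta> \<and> (i, j') \<in> skew_diagram \<alpha> \<beta> \<and> j < j'
        \<longrightarrow> T (i, j) < T (i, j'))}"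

text \<open>The filling that puts \<open>k\<close> into the \<open>k\<close>-th cell of the list \<open>cs\<close> of distinct cells.\<close>

definition fill_along :: "(nat \<times> nat) list \<Rightarrow> tableau" where
  "fill_along cs = restrict (\<lambda>c. the (map_of (zip cs [1 ..< length cs + 1]) c)) (set cs)"

definition S0 :: "nat list \<Rightarrow> nat list \<Rightarrow> tableau" where
  "S0 \<alpha> \<beta> = fill_along
     (map (\<lambda>i. (i, 1)) [length \<beta> + 1 ..< length \<alpha> + 1] @
      concat (map (\<lambda>i. filter (\<lambda>c. snd c \<noteq> 1) (skew_row \<alpha> \<beta> i)) (rev [1 ..< length \<alpha> + 1])))"

definition Srow :: "nat list \<Rightarrow> nat list \<Rightarrow> tableau" where
  "Srow \<alpha> \<beta> = fill_along (concat (map (skew_row \<alpha> \<beta>) [1 ..< length \<alpha> + 1]))"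

section \<open>The action and the skew immaculate Hecke poset\<close>

definition row_of :: "nat list \<Rightarrow> nat list \<Rightarrow> tableau \<Rightarrow> nat \<Rightarrow> nat" where
  "row_of \<alpha> \<beta> T k = fst (inv_into (skew_diagram \<alpha> \<beta>) T k)"

text \<open>\<open>None\<close> stands for the zero vector of the module spanned by the tableaux.\<close>

definition hecke_pi :: "nat list \<Rightarrow> nat list \<Rightarrow> nat \<Rightarrow> tableau \<Rightarrow> tableau option" where
  "hecke_pi \<alpha> \<beta> i T =
     (if row_of \<alpha> \<beta> T i < row_of \<alpha> \<beta> T (i + 1) then Some T
      else if row_of \<alpha> \<beta> T (i + 1) < row_of \<alpha> \<beta> T i
        then Some (restrict (transpose i (i + 1) \<circ> T) (skew_diagram \<alpha> \<beta>))
      else None)"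

definition hecke_step :: "nat list \<Rightarrow> nat list \<Rightarrow> (tableau \<times> tableau) set" where
  "hecke_step \<alpha> \<beta> = {(S, T). S \<in> SIT \<alpha> \<beta> \<and> T \<in> SIT \<alpha> \<beta> \<and> S \<noteq> T \<and>
     (\<exists>i. 1 \<le> i \<and> i + 1 \<le> skew_size \<alpha> \<beta> \<and> hecke_pi \<alpha> \<beta> i S = Some T)}"

text \<open>A partial order on a finite set is the reflexive transitive closure of its cover
  relation.\<close>

definition hecke_order :: "nat list \<Rightarrow> nat list \<Rightarrow> (tableau \<times> tableau) set" where
  "hecke_order \<alpha> \<beta> = (hecke_step \<alpha> \<beta>)\<^sup>* \<inter> SIT \<alpha> \<beta> \<times> SIT \<alpha> \<beta>"

section \<open>Inversions\<close>

definition reading_word :: "nat list \<Rightarrow> nat list \<Rightarrow> tableau \<Rightarrow> nat list" where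
  "reading_word \<alpha> \<beta> T =
     concat (map (\<lambda>i. map T (rev (skew_row \<alpha> \<beta> i))) (rev [1 ..< length \<alpha> + 1]))"

definition word_inversions :: "nat list \<Rightarrow> nat" where
  "word_inversions w = card {(p, q). p < q \<and> q < length w \<and> w ! p > w ! q}"

definition tab_inv :: "nat list \<Rightarrow> nat list \<Rightarrow> tableau \<Rightarrow> nat" where
  "tab_inv \<alpha> \<beta> T = word_inversions (reading_word \<alpha> \<beta> T)"

end

theory Submission
  imports Defs
begin

text \<open>A step of the action makes \<open>i\<close> and \<open>i + 1\<close> an inversion and changes no other pair, so it
  raises \<open>inv\<close> by exactly \<open>1\<close>. Both \<open>S0\<close> and \<open>Srow\<close> are the filling that increases along a
  total order of the cells, and a tableau in which every pair \<open>k\<close>, \<open>k + 1\<close> respects such an order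
  is that filling. A pair violating the order of \<open>S0\<close> can be undone by a step into the tableau, and
  a pair violating the order of \<open>Srow\<close> allows a step out of it; so \<open>S0\<close> is the only source and
  \<open>Srow\<close> the only sink. Every maximal chain then meets each value of \<open>inv\<close> between the two
  exactly once. In \<open>S0\<close> the inversions are the pairs within a row and the pairs whose lower cell
  is in the first column.\<close>

section \<open>Finite posets generated by steps of height one\<close>

text \<open>The abstract situation: \<open>s\<close> stands for the nontrivial steps of the action
  and \<open>f\<close> for \<open>tab_inv\<close>. The last two assumptions leave \<open>b\<close>
  as the only possible source and \<open>t\<close> as the only possible sink.\<close>

locale unit_step_poset =
  fixes A :: "'a set" and s :: "('a \<times> 'a) set" and f :: "'a \<Rightarrow> nat" and b t :: 'a
  assumes finite_A: "finite A"
    and step_carrier: "s \<subseteq> A \<times> A"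
    and step_height: "(x, y) \<in> s \<Longrightarrow> f y = Suc (f x)"
    and bottom_in: "b \<in> A" and top_in: "t \<in> A"
    and step_into: "\<lbrakk>x \<in> A; x \<noteq> b\<rbrakk> \<Longrightarrow> \<exists>y. (y, x) \<in> s"
    and step_from: "\<lbrakk>x \<in> A; x \<noteq> t\<rbrakk> \<Longrightarrow> \<exists>y. (x, y) \<in> s"
begin

text \<open>The intersection only discards the pairs \<open>(x, x)\<close> with \<open>x\<close>
  outside \<open>A\<close>, which the reflexive closure contains.\<close>

definition "step_order = s\<^sup>* \<inter> A \<times> A"

lemma height_mono: "(x, y) \<in> s\<^sup>* \<Longrightarrow> x = y \<or> f x < f y"
  by (induction rule: rtrancl_induct) (auto dest: step_height)

text \<open>Every step backwards lowers \<open>f\<close>, so a backward walk from \<open>x\<close>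
  ends, and it can end only at \<open>b\<close>.\<close>

lemma bottom_le: "x \<in> A \<Longrightarrow> (b, x) \<in> s\<^sup>*"
proof (induction "f x" arbitrary: x rule: less_induct)
  case less
  show ?case
  proof (cases "x = b")
    case False
    then obtain y where y: "(y, x) \<in> s" using step_into less.prems by blast
    then have "(b, y) \<in> s\<^sup>*" using less.hyps[of y] step_height[OF y] step_carrier by auto
    with y show ?thesis by simp
  qed simp
qed

text \<open>Dual to \<open>bottom_le\<close>. Finiteness of \<open>A\<close> bounds
  \<open>f\<close>, so the distance to the maximal height serves as the measure.\<close>

lemma le_top: "x \<in> A \<Longrightarrow> (x, t) \<in> s\<^sup>*"
proof (induction "Max (f ` A) - f x" arbitrary: x rule: less_induct)
  case less
  show ?case
  proof (cases "x = t")
    case False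
    then obtain y where y: "(x, y) \<in> s" using step_from less.prems by blast
    then have "y \<in> A" using step_carrier by auto
    then have "f y \<le> Max (f ` A)" using finite_A by simp
    then have "(y, t) \<in> s\<^sup>*" using less.hyps[of y] step_height[OF y] \<open>y \<in> A\<close> by auto
    with y show ?thesis by (simp add: converse_rtrancl_into_rtrancl)
  qed simp
qed

lemma partial_order: "partial_order_on A step_order"
proof -
  have "antisym step_order"
  proof (rule antisymI)
    fix x y assume "(x, y) \<in> step_order" "(y, x) \<in> step_order"
    then show "x = y" using height_mono[of x y] height_mono[of y x] by (auto simp: step_order_def)
  qed
  moreover have "trans step_order" by (auto simp: trans_def step_order_def)
  ultimately show ?thesis
    by (auto simp: partial_order_on_def preorder_on_def refl_on_def step_order_def)
qed

text \<open>Adding \<open>z\<close> to \<open>M\<close> leaves a chain, since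
  \<open>z \<in> A\<close> makes \<open>z\<close> comparable to itself; maximality then forbids a
  proper extension.\<close>

lemma maximal_chain_insert:
  assumes "M \<in> maximal_chains step_order" "z \<in> A" "\<And>w. w \<in> M \<Longrightarrow> (z, w) \<in> step_order \<or> (w, z) \<in> step_order"
  shows "z \<in> M"
proof -
  have "insert z M \<in> Chains step_order"
    using assms by (auto simp: maximal_chains_def Chains_def step_order_def)
  then show ?thesis using assms(1) unfolding maximal_chains_def by blast
qed

lemma chain_subset: "M \<in> Chains step_order \<Longrightarrow> M \<subseteq> A"
  by (auto simp: Chains_def step_order_def)

text \<open>Comparability is built into a chain, and \<open>height_mono\<close> rules out a
  comparison against the heights unless the two elements coincide.\<close>

lemma chain_le_iff:
  assumes "M \<in> Chains step_order" "x \<in> M" "y \<in> M"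
  shows "(x, y) \<in> step_order \<longleftrightarrow> f x \<le> f y"
proof -
  have "(x, y) \<in> step_order \<or> (y, x) \<in> step_order" using assms by (auto simp: Chains_def)
  then show ?thesis using height_mono[of x y] height_mono[of y x] by (auto simp: step_order_def)
qed

lemma card_maximal_chain:
  assumes M: "M \<in> maximal_chains step_order"
  shows "finite M \<and> card M = f t - f b + 1"
proof -
  have ch: "M \<in> Chains step_order" using M by (simp add: maximal_chains_def)
  have sub: "M \<subseteq> A" using chain_subset[OF ch] .
  have fin: "finite M" using sub finite_A finite_subset by blast
  have b: "b \<in> M"
    by (rule maximal_chain_insert[OF M bottom_in]) (use sub bottom_in bottom_le in \<open>auto simp: step_order_def\<close>)
  have t: "t \<in> M"
    by (rule maximal_chain_insert[OF M top_in]) (use sub top_in le_top in \<open>auto simp: step_order_def\<close>)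
  have inj: "inj_on f M"
  proof (rule inj_onI)
    fix x y assume "x \<in> M" "y \<in> M" "f x = f y"
    then show "x = y"
      using chain_le_iff[OF ch, of x y] height_mono[of x y] by (auto simp: step_order_def)
  qed
  have "n \<in> f ` M" if "f b \<le> n" "n \<le> f t" for n
    using that
  proof (induction n rule: dec_induct)
    case base
    show ?case using b by simp
  next
    case (step n)
    then obtain x where x: "x \<in> M" "f x = n" by fastforce
    \<comment> \<open>No height is skipped: let \<open>y\<close> be a lowest member of
      \<open>M\<close> above height \<open>n\<close>. The first step \<open>z\<close> of a path from
      \<open>x\<close> to \<open>y\<close> has height \<open>n + 1\<close>, and maximality puts it
      into \<open>M\<close>.\<close>
    let ?U = "{w \<in> M. n < f w}"
    have "t \<in> ?U" using t step.prems by simp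
    then obtain y where y: "y \<in> ?U" and ymin: "\<And>w. w \<in> ?U \<Longrightarrow> f y \<le> f w"
      using ex_has_least_nat[of "\<lambda>w. w \<in> ?U" t f] by blast
    have "(x, y) \<in> s\<^sup>*" using chain_le_iff[OF ch x(1), of y] x y by (auto simp: step_order_def)
    then obtain z where z: "(x, z) \<in> s" "(z, y) \<in> s\<^sup>*"
      using x y by (metis (mono_tags, lifting) converse_rtranclE less_irrefl mem_Collect_eq)
    have zA: "z \<in> A" using z step_carrier by auto
    have "z \<in> M"
    proof (rule maximal_chain_insert[OF M zA])
      fix w assume w: "w \<in> M"
      show "(z, w) \<in> step_order \<or> (w, z) \<in> step_order"
      \<comment> \<open>A member of \<open>M\<close> lies at or below \<open>x\<close> or, by the
        choice of \<open>y\<close>, at or above \<open>y\<close>; either way it is comparable with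
        \<open>z\<close>.\<close>
      proof (cases "f w \<le> n")
        case True
        then have "(w, x) \<in> step_order" using chain_le_iff[OF ch w x(1)] x by simp
        then show ?thesis using rtrancl_into_rtrancl[OF _ z(1), of w] zA by (auto simp: step_order_def)
      next
        case False
        then have "(y, w) \<in> step_order" using chain_le_iff[OF ch _ w, of y] y ymin w by simp
        then show ?thesis using rtrancl_trans[OF z(2), of w] zA by (auto simp: step_order_def)
      qed
    qed
    then show ?case using step_height[OF z(1)] x(2) by force
  qed
  moreover have "f x \<in> {f b..f t}" if "x \<in> M" for x
    using that sub height_mono[OF bottom_le, of x] height_mono[OF le_top, of x] by fastforce
  ultimately have "f ` M = {f b..f t}" by auto
  moreover have "f b \<le> f t" using height_mono[OF bottom_le[OF top_in]] by auto
  ultimately show ?thesis using fin card_image[OF inj] by simp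
qed

text \<open>Without a maximal chain the length condition would hold vacuously for every
  \<open>n\<close>, and \<open>poset_rank\<close> would not be determined.\<close>

lemma maximal_chain_exists: "\<exists>M. M \<in> maximal_chains step_order"
proof -
  have "finite (Chains step_order)"
    by (rule finite_subset[of _ "Pow A"]) (use chain_subset finite_A in auto)
  moreover have "{} \<in> Chains step_order" by (simp add: Chains_def)
  ultimately obtain M where "M \<in> Chains step_order" "\<forall>C\<in>Chains step_order. M \<le> C \<longrightarrow> M = C"
    using finite_has_maximal[of "Chains step_order"] by blast
  then show ?thesis unfolding maximal_chains_def by blast
qed

lemma max_chains_length_iff: "max_chains_have_length step_order n \<longleftrightarrow> n = f t - f b"
  using maximal_chain_exists card_maximal_chain by (auto simp: max_chains_have_length_def)

lemma graded: "graded_poset A step_order"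
  using partial_order max_chains_length_iff by (simp add: graded_poset_def)

lemma rank: "poset_rank step_order = f t - f b"
  by (simp add: poset_rank_def max_chains_length_iff)

text \<open>A path from \<open>x\<close> to \<open>y\<close> starts with a step to some
  \<open>z\<close> between them; for a cover this forces \<open>z = y\<close>, and a single step
  raises \<open>f\<close> by 1.\<close>

lemma rank_function: "is_rank_function A step_order (\<lambda>x. int (f x) - int (f b))"
  unfolding is_rank_function_def
proof (intro conjI ballI impI)
  fix x assume x: "x \<in> A" "\<forall>y. (y, x) \<in> step_order \<longrightarrow> y = x"
  then have "x = b" using bottom_le bottom_in by (auto simp: step_order_def)
  then show "int (f x) - int (f b) = 0" by simp
next
  fix x y assume "covered_by step_order x y"
  then have xy: "(x, y) \<in> s\<^sup>*" "x \<noteq> y" "y \<in> A" "x \<in> A"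
    and between: "\<And>z. (x, z) \<in> step_order \<Longrightarrow> (z, y) \<in> step_order \<Longrightarrow> z = x \<or> z = y"
    by (auto simp: covered_by_def step_order_def)
  then obtain z where z: "(x, z) \<in> s" "(z, y) \<in> s\<^sup>*" by (meson converse_rtranclE)
  then have "z = x \<or> z = y" using between[of z] step_carrier xy by (auto simp: step_order_def)
  then have "f y = Suc (f x)" using step_height[OF z(1)] by auto
  then show "int (f y) - int (f b) = int (f x) - int (f b) + 1" by simp
qed

end

section \<open>Words and fillings along an order\<close>

lemma sorted_wrt_concat_map:
  assumes "sorted_wrt (\<lambda>x y. \<forall>a\<in>set (f x). \<forall>b\<in>set (f y). R a b) xs"
    and "\<And>x. x \<in> set xs \<Longrightarrow> sorted_wrt R (f x)"
  shows "sorted_wrt R (concat (map f xs))"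
  using assms by (induction xs) (auto simp: sorted_wrt_append)

lemma sorted_wrt_asymp_distinct:
  assumes "sorted_wrt R xs" "asymp R"
  shows "distinct xs"
  using assms by (induction xs) (auto dest: asympD)

lemma sorted_wrt_nth_iff:
  assumes "sorted_wrt R cs" "asymp R" "p < length cs" "q < length cs"
  shows "R (cs ! p) (cs ! q) \<longleftrightarrow> p < q"
  using assms by (metis asympD linorder_neqE_nat sorted_wrt_iff_nth_less)

text \<open>A list sorted by an asymmetric relation has no repetitions, and its positions compare as
  its members do under \<open>R\<close>. Hence pairs of positions can be traded for pairs of
  members.\<close>

lemma word_inversions_map:
  assumes sorted: "sorted_wrt R cs" and asym: "asymp R"
  shows "word_inversions (map T cs) = card {(c, d) \<in> set cs \<times> set cs. R c d \<and> T d < T c}"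
proof -
  have dist: "distinct cs"
    by (rule sorted_wrt_asymp_distinct[OF sorted asym])
  let ?P = "{(p, q). p < q \<and> q < length (map T cs) \<and> map T cs ! p > map T cs ! q}"
  have "bij_betw (\<lambda>(p, q). (cs ! p, cs ! q)) ?P
          {(c, d) \<in> set cs \<times> set cs. R c d \<and> T d < T c}"
    unfolding bij_betw_def
  proof
    show "inj_on (\<lambda>(p, q). (cs ! p, cs ! q)) ?P"
      using dist by (auto simp: inj_on_def nth_eq_iff_index_eq)
    show "(\<lambda>(p, q). (cs ! p, cs ! q)) ` ?P = {(c, d) \<in> set cs \<times> set cs. R c d \<and> T d < T c}"
    proof (intro equalityI subsetI)
      fix x assume "x \<in> {(c, d) \<in> set cs \<times> set cs. R c d \<and> T d < T c}"
      then obtain p q where "x = (cs ! p, cs ! q)" "p < length cs" "q < length cs"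
        "R (cs ! p) (cs ! q)" "T (cs ! q) < T (cs ! p)" by (auto simp: in_set_conv_nth)
      then show "x \<in> (\<lambda>(p, q). (cs ! p, cs ! q)) ` ?P"
        using sorted_wrt_nth_iff[OF sorted asym, of p q] by (auto intro!: image_eqI[of _ _ "(p, q)"])
    qed (use sorted_wrt_nth_iff[OF sorted asym] in auto)
  qed
  then show ?thesis unfolding word_inversions_def by (rule bij_betw_same_card)
qed

lemma fill_along_nth:
  assumes "distinct cs" "k < length cs"
  shows "fill_along cs (cs ! k) = k + 1"
proof -
  have "map_of (zip cs [1..<length cs + 1]) (cs ! k) = Some ([1..<length cs + 1] ! k)"
    using assms by (intro map_of_zip_nth) auto
  \<comment> \<open>Positions count from 0, entries from 1.\<close>
  also have "[1..<length cs + 1] ! k = k + 1"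
    using assms by (subst nth_upt) auto
  finally show ?thesis using assms by (simp add: fill_along_def del: upt_Suc)
qed

lemma fill_along_bij:
  assumes "distinct cs"
  shows "bij_betw (fill_along cs) (set cs) {1..length cs}"
proof -
  have "inj_on (fill_along cs) (set cs)"
  proof (rule inj_onI)
    fix c d assume "c \<in> set cs" "d \<in> set cs" and eq: "fill_along cs c = fill_along cs d"
    then obtain k l where "c = cs ! k" "d = cs ! l" "k < length cs" "l < length cs"
      by (metis in_set_conv_nth)
    then show "c = d" using eq fill_along_nth[OF assms] by simp
  qed
  moreover have "fill_along cs ` set cs = {1..length cs}"
  proof
    show "fill_along cs ` set cs \<subseteq> {1..length cs}"
    proof (rule image_subsetI)
      fix c assume "c \<in> set cs"
      then obtain k where "c = cs ! k" "k < length cs" by (metis in_set_conv_nth)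
      then show "fill_along cs c \<in> {1..length cs}" using fill_along_nth[OF assms] by simp
    qed
    show "{1..length cs} \<subseteq> fill_along cs ` set cs"
    proof
      fix n assume "n \<in> {1..length cs}"
      then have "fill_along cs (cs ! (n - 1)) = n" "cs ! (n - 1) \<in> set cs"
        using fill_along_nth[OF assms, of "n - 1"] by auto
      then show "n \<in> fill_along cs ` set cs" by (metis imageI)
    qed
  qed
  ultimately show ?thesis by (simp add: bij_betw_def)
qed

lemma fill_along_mono:
  assumes "sorted_wrt Q cs" "asymp Q" "c \<in> set cs" "d \<in> set cs" "Q c d"
  shows "fill_along cs c < fill_along cs d"
proof -
  have dist: "distinct cs"
    by (rule sorted_wrt_asymp_distinct[OF assms(1,2)])
  obtain k l where "c = cs ! k" "d = cs ! l" "k < length cs" "l < length cs"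
    using assms(3,4) by (auto simp: in_set_conv_nth)
  then show ?thesis
    using sorted_wrt_nth_iff[OF assms(1,2)] assms(5) fill_along_nth[OF dist] by simp
qed

text \<open>A bijection onto \<open>{1..N}\<close> sends \<open>c\<close> to the number of elements
  with value at most \<open>T c\<close>; by monotonicity and totality these are \<open>c\<close> and
  its predecessors under \<open>Q\<close>. The count does not mention \<open>T\<close>, so the order
  alone determines the filling.\<close>

lemma monotone_bij_value:
  fixes T :: "'a \<Rightarrow> nat"
  assumes bij: "bij_betw T D {1..N}" and asym: "asymp Q" and total: "totalp_on D Q"
    and mono: "\<And>c d. \<lbrakk>c \<in> D; d \<in> D; Q c d\<rbrakk> \<Longrightarrow> T c < T d"
    and c: "c \<in> D"
  shows "T c = card {d \<in> D. d = c \<or> Q d c}"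
proof -
  have "{d \<in> D. d = c \<or> Q d c} = {d \<in> D. T d \<le> T c}"
  proof (intro Collect_cong conj_cong refl)
    fix d assume d: "d \<in> D"
    show "(d = c \<or> Q d c) \<longleftrightarrow> T d \<le> T c"
      using mono[of d c] mono[of c d] c d totalp_onD[OF total d c] by (metis leD less_imp_le order_refl)
  qed
  moreover have "T ` {d \<in> D. T d \<le> T c} = {1..T c}"
  proof -
    have img: "T ` D = {1..N}" using bij by (simp add: bij_betw_def)
    then have "T c \<le> N" using c by auto
    have "T ` {d \<in> D. T d \<le> T c} = T ` D \<inter> {..T c}" by auto
    also have "\<dots> = {1..T c}" unfolding img using \<open>T c \<le> N\<close> by auto
    finally show ?thesis .
  qed
  moreover have "inj_on T {d \<in> D. T d \<le> T c}"
    using bij by (auto simp: bij_betw_def inj_on_def)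
  ultimately show ?thesis using card_image[of T "{d \<in> D. T d \<le> T c}"] by simp
qed

text \<open>Exchanging adjacent numbers reverses the comparison of these two only.\<close>

lemma transpose_Suc_less_iff:
  "transpose k (Suc k) a < transpose k (Suc k) b \<longleftrightarrow>
     a < b \<and> \<not> (a = k \<and> b = Suc k) \<or> a = Suc k \<and> b = k"
  by (auto simp: transpose_def)

section \<open>Skew immaculate tableaux\<close>

definition read_before :: "nat \<times> nat \<Rightarrow> nat \<times> nat \<Rightarrow> bool" where
  "read_before c d \<longleftrightarrow> fst d < fst c \<or> fst c = fst d \<and> snd d < snd c"

text \<open>The order in which \<open>S0\<close> fills the cells. By contrast,
  \<open>read_before\<close> is the order of the reading word, and its converse is the order in
  which \<open>Srow\<close> fills.\<close>

definition col_first :: "nat \<times> nat \<Rightarrow> nat \<times> nat \<Rightarrow> bool" where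
  "col_first c d \<longleftrightarrow>
     (if snd c = 1 then snd d \<noteq> 1 \<or> fst c < fst d
      else snd d \<noteq> 1 \<and> (fst d < fst c \<or> fst c = fst d \<and> snd c < snd d))"

lemma asymp_read_before: "asymp read_before"
  by (auto simp: asymp_on_def read_before_def)

lemma asymp_read_before_conv: "asymp (\<lambda>c d. read_before d c)"
  by (auto simp: asymp_on_def read_before_def)

lemma transp_read_before_conv: "transp (\<lambda>c d. read_before d c)"
  by (auto simp: transp_on_def read_before_def)

lemma totalp_read_before_conv: "totalp_on D (\<lambda>c d. read_before d c)"
  by (auto simp: totalp_on_def read_before_def prod_eq_iff)

lemma asymp_col_first: "asymp col_first"
  by (auto simp: asymp_on_def col_first_def)

lemma transp_col_first: "transp col_first"
  by (auto simp: transp_on_def col_first_def split: if_splits)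

lemma totalp_col_first: "totalp_on D col_first"
  by (auto simp: totalp_on_def col_first_def prod_eq_iff)

section \<open>Cells of skew diagrams and inversions as pairs of cells\<close>

lemma part_pos_iff: "composition \<alpha> \<Longrightarrow> 0 < part \<alpha> i \<longleftrightarrow> 1 \<le> i \<and> i \<le> length \<alpha>"
  by (auto simp: composition_def part_def)

lemma sum_list_part: "sum_list \<alpha> = (\<Sum>i = 1..length \<alpha>. part \<alpha> i)"
proof -
  have "sum_list \<alpha> = (\<Sum>i<length \<alpha>. part \<alpha> (Suc i))"
    by (simp add: sum_list_sum_nth part_def atLeast0LessThan)
  also have "\<dots> = (\<Sum>i = 1..length \<alpha>. part \<alpha> i)"
    by (rule sum.reindex_bij_witness[of _ "\<lambda>i. i - 1" Suc]) auto
  finally show ?thesis .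
qed

lemma diagram_Sigma: "diagram \<alpha> = Sigma {1..length \<alpha>} (\<lambda>i. {1..part \<alpha> i})"
  by (auto simp: diagram_def)

lemma card_diagram: "finite (diagram \<alpha>) \<and> card (diagram \<alpha>) = sum_list \<alpha>"
  by (simp add: diagram_Sigma sum_list_part)

text \<open>The bounds on the row are implied: \<open>part \<alpha> i\<close> is 0 outside the rows
  of \<open>\<alpha>\<close>, which leaves no room for \<open>j\<close>.\<close>

lemma mem_skew_diagram: "(i, j) \<in> skew_diagram \<alpha> \<beta> \<longleftrightarrow> part \<beta> i < j \<and> j \<le> part \<alpha> i"
  by (auto simp: skew_diagram_def diagram_def part_def split: if_splits)

lemma skew_diagram_Sigma:
  "skew_diagram \<alpha> \<beta> = Sigma {1..length \<alpha>} (\<lambda>i. {part \<beta> i + 1..part \<alpha> i})"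
  by (auto simp: mem_skew_diagram part_def split: if_splits)

lemma finite_skew_diagram: "finite (skew_diagram \<alpha> \<beta>)"
  by (simp add: skew_diagram_Sigma)

lemma set_skew_row: "set (skew_row \<alpha> \<beta> i) = {i} \<times> {part \<beta> i + 1..part \<alpha> i}"
  by (auto simp: skew_row_def)

lemma skew_row_sorted: "sorted_wrt (\<lambda>c d. fst c = fst d \<and> snd c < snd d) (skew_row \<alpha> \<beta> i)"
  by (simp add: skew_row_def sorted_wrt_map del: upt_Suc)

lemma tab_inv_card:
  "tab_inv \<alpha> \<beta> T =
    card {(c, d) \<in> skew_diagram \<alpha> \<beta> \<times> skew_diagram \<alpha> \<beta>. read_before c d \<and> T d < T c}"
proof -
  let ?cs = "concat (map (\<lambda>i. rev (skew_row \<alpha> \<beta> i)) (rev [1..<length \<alpha> + 1]))"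
  have "sorted_wrt read_before (rev (skew_row \<alpha> \<beta> i))" for i
    using skew_row_sorted[of \<alpha> \<beta> i] unfolding sorted_wrt_rev
    by (rule sorted_wrt_mono_rel[rotated]) (auto simp: read_before_def)
  moreover have "sorted_wrt (\<lambda>i i'. \<forall>c\<in>set (rev (skew_row \<alpha> \<beta> i)).
      \<forall>d\<in>set (rev (skew_row \<alpha> \<beta> i')). read_before c d) (rev [1..<length \<alpha> + 1])"
    unfolding sorted_wrt_rev
    by (rule sorted_wrt_mono_rel[OF _ sorted_wrt_upt]) (auto simp: set_skew_row read_before_def)
  ultimately have "sorted_wrt read_before ?cs" by (intro sorted_wrt_concat_map)
  moreover have "set ?cs = skew_diagram \<alpha> \<beta>"
    by (auto simp: skew_diagram_Sigma set_skew_row)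
  moreover have "reading_word \<alpha> \<beta> T = map T ?cs"
    by (simp add: reading_word_def map_concat comp_def rev_map)
  ultimately show ?thesis
    using word_inversions_map[OF _ asymp_read_before] by (simp add: tab_inv_def)
qed

text \<open>Groups the inversions by their larger entry, the form in which \<open>Srow\<close> and
  \<open>S0\<close> are counted.\<close>

lemma tab_inv_sum:
  "tab_inv \<alpha> \<beta> T =
    (\<Sum>c\<in>skew_diagram \<alpha> \<beta>. card {d \<in> skew_diagram \<alpha> \<beta>. read_before c d \<and> T d < T c})"
proof -
  have "{(c, d) \<in> skew_diagram \<alpha> \<beta> \<times> skew_diagram \<alpha> \<beta>. read_before c d \<and> T d < T c} =
      Sigma (skew_diagram \<alpha> \<beta>) (\<lambda>c. {d \<in> skew_diagram \<alpha> \<beta>. read_before c d \<and> T d < T c})"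
    by auto
  then show ?thesis by (simp add: tab_inv_card finite_skew_diagram)
qed

section \<open>Binomial sums\<close>

lemma choose_two_add: "(m + n) choose 2 = (m choose 2) + m * n + (n choose 2)"
  by (induction m) (auto simp: numeral_2_eq_2)

text \<open>The inversions contributed by one row of \<open>S0\<close>: the cell in column
  \<open>j\<close> has \<open>j - 1 - b\<close> cells of the row to its left and \<open>k\<close>
  first-column cells in lower rows. Both sides are 0 if \<open>a \<le> b\<close>.\<close>

lemma sum_shifted_row:
  "(\<Sum>j = b + 1..a. (j - 1 - b) + k) = ((a - b) choose 2) + (a - b) * (k::nat)"
proof (induction a)
  case (Suc a)
  show ?case
  proof (cases "b \<le> a")
    case True
    then show ?thesis using Suc by (simp add: Suc_diff_le numeral_2_eq_2)
  qed simp
qed simp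

text \<open>The hockey-stick identity, source of the \<open>choose 3\<close> term for
  \<open>S0\<close>.\<close>

lemma sum_shifted_choose_two:
  "(\<Sum>i = l + 1..m. (i - l - 1) choose 2) = (m - l) choose 3"
proof (induction m)
  case (Suc m)
  show ?case
  proof (cases "l \<le> m")
    case True
    then show ?thesis using Suc by (simp add: Suc_diff_le numeral_2_eq_2 numeral_3_eq_3)
  qed simp
qed simp

section \<open>Tableaux of a fixed skew shape and switches of entries\<close>

locale skew_shape =
  fixes \<alpha> \<beta> :: "nat list"
  assumes comp_outer: "composition \<alpha>" and comp_inner: "composition \<beta>"
    and inner_subset: "comp_subset \<beta> \<alpha>"
begin

abbreviation "D \<equiv> skew_diagram \<alpha> \<beta>"
abbreviation "N \<equiv> skew_size \<alpha> \<beta>"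

text \<open>The switching branch of \<open>hecke_pi\<close>; the restriction keeps the result
  extensional on \<open>D\<close>, as \<open>SIT\<close> demands.\<close>

definition swap :: "nat \<Rightarrow> tableau \<Rightarrow> tableau" where
  "swap k T = restrict (transpose k (Suc k) \<circ> T) D"

lemma card_D: "card D = N"
proof -
  have "diagram \<beta> \<subseteq> diagram \<alpha>"
    using inner_subset by (auto simp: diagram_def comp_subset_def) (meson atLeastAtMost_iff le_trans)
  then show ?thesis
    using card_diagram[of \<alpha>] card_diagram[of \<beta>] card_Diff_subset[of "diagram \<beta>" "diagram \<alpha>"]
    by (simp add: skew_diagram_def skew_size_def)
qed

text \<open>All parts are positive, so each row of \<open>\<alpha>\<close> has a first cell and each
  row of \<open>\<beta>\<close> covers it.\<close>

lemma first_col: "(i, 1) \<in> D \<longleftrightarrow> length \<beta> < i \<and> i \<le> length \<alpha>"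
proof -
  have "(i, 1) \<in> D \<longleftrightarrow> \<not> 0 < part \<beta> i \<and> 0 < part \<alpha> i" by (auto simp: mem_skew_diagram)
  also have "\<dots> \<longleftrightarrow> length \<beta> < i \<and> i \<le> length \<alpha>"
    using part_pos_iff[OF comp_outer, of i] part_pos_iff[OF comp_inner, of i] by auto
  finally show ?thesis .
qed

lemma col_pos: "c \<in> D \<Longrightarrow> 1 \<le> snd c"
  by (cases c) (simp add: mem_skew_diagram)

lemma SIT_bij: "T \<in> SIT \<alpha> \<beta> \<Longrightarrow> bij_betw T D {1..N}"
  by (simp add: SIT_def)

lemma SIT_inj: "\<lbrakk>T \<in> SIT \<alpha> \<beta>; c \<in> D; d \<in> D; T c = T d\<rbrakk> \<Longrightarrow> c = d"
  using SIT_bij by (auto simp: bij_betw_def inj_on_def)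

lemma SIT_row: "\<lbrakk>T \<in> SIT \<alpha> \<beta>; c \<in> D; d \<in> D; fst c = fst d; snd c < snd d\<rbrakk> \<Longrightarrow> T c < T d"
  unfolding SIT_def by (cases c; cases d) auto

lemma SIT_col: "\<lbrakk>T \<in> SIT \<alpha> \<beta>; c \<in> D; d \<in> D; snd c = 1; snd d = 1; fst c < fst d\<rbrakk> \<Longrightarrow> T c < T d"
  unfolding SIT_def by (cases c; cases d) auto

lemma SIT_I:
  assumes "T \<in> extensional D" "bij_betw T D {1..N}"
    and "\<And>c d. \<lbrakk>c \<in> D; d \<in> D; fst c = fst d; snd c < snd d\<rbrakk> \<Longrightarrow> T c < T d"
    and "\<And>c d. \<lbrakk>c \<in> D; d \<in> D; snd c = 1; snd d = 1; fst c < fst d\<rbrakk> \<Longrightarrow> T c < T d"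
  shows "T \<in> SIT \<alpha> \<beta>"
  using assms unfolding SIT_def by auto

lemma finite_SIT: "finite (SIT \<alpha> \<beta>)"
proof (rule finite_subset)
  show "SIT \<alpha> \<beta> \<subseteq> PiE D (\<lambda>_. {1..N})"
    by (auto simp: SIT_def PiE_def dest!: bij_betw_imp_funcset)
qed (simp add: finite_PiE finite_skew_diagram)

lemma row_of_entry: "\<lbrakk>T \<in> SIT \<alpha> \<beta>; c \<in> D\<rbrakk> \<Longrightarrow> row_of \<alpha> \<beta> T (T c) = fst c"
  using SIT_bij[of T] by (simp add: row_of_def bij_betw_def)

lemma swap_apply: "c \<in> D \<Longrightarrow> swap k T c = transpose k (Suc k) (T c)"
  by (simp add: swap_def)

lemma swap_swap: "T \<in> SIT \<alpha> \<beta> \<Longrightarrow> swap k (swap k T) = T"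
  unfolding SIT_def by (auto intro!: extensionalityI[of _ D] simp: swap_def)

text \<open>Only the order of the two switched entries changes, and the tableau conditions compare
  them only if their cells share a row or both lie in the first column.\<close>

lemma swap_in_SIT:
  assumes T: "T \<in> SIT \<alpha> \<beta>" and cd: "c \<in> D" "d \<in> D" "T d = Suc (T c)"
    and rows: "fst c \<noteq> fst d" and col: "\<not> (snd c = 1 \<and> snd d = 1)"
  shows "swap (T c) T \<in> SIT \<alpha> \<beta>"
proof (rule SIT_I)
  have kN: "1 \<le> T c" "Suc (T c) \<le> N"
    using SIT_bij[OF T] cd by (metis atLeastAtMost_iff bij_betwE)+
  have "bij_betw (transpose (T c) (Suc (T c))) {1..N} {1..N}"
    using kN by (intro bij_betw_transpose_iff) auto
  then have "bij_betw (transpose (T c) (Suc (T c)) \<circ> T) D {1..N}"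
    using SIT_bij[OF T] by (metis bij_betw_trans)
  then show "bij_betw (swap (T c) T) D {1..N}"
    by (rule bij_betw_cong[THEN iffD1, rotated]) (simp add: swap_def)
  fix x y assume xy: "x \<in> D" "y \<in> D"
  have eq: "x = c \<and> y = d" if "T x = T c" "T y = Suc (T c)"
    using that xy cd SIT_inj[OF T] by metis
  show "swap (T c) T x < swap (T c) T y" if "fst x = fst y" "snd x < snd y"
    using SIT_row[OF T xy that] xy eq rows that by (auto simp: swap_apply transpose_Suc_less_iff)
  show "swap (T c) T x < swap (T c) T y" if "snd x = 1" "snd y = 1" "fst x < fst y"
    using SIT_col[OF T xy that] xy eq col that by (auto simp: swap_apply transpose_Suc_less_iff)
qed (simp add: swap_def)

section \<open>Steps of the action\<close>

lemma hecke_stepE: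
  assumes "(S, T) \<in> hecke_step \<alpha> \<beta>"
  obtains c d where "S \<in> SIT \<alpha> \<beta>" "T \<in> SIT \<alpha> \<beta>" "c \<in> D" "d \<in> D" "S d = Suc (S c)"
    "fst d < fst c" "T = swap (S c) S"
proof -
  obtain i where S: "S \<in> SIT \<alpha> \<beta>" and T: "T \<in> SIT \<alpha> \<beta>" and "S \<noteq> T"
    and i: "1 \<le> i" "i + 1 \<le> N" and pi: "hecke_pi \<alpha> \<beta> i S = Some T"
    using assms by (auto simp: hecke_step_def)
  have "S ` D = {1..N}" using SIT_bij[OF S] by (simp add: bij_betw_def)
  then have "i \<in> S ` D" "Suc i \<in> S ` D" using i by auto
  then obtain c d where cd: "c \<in> D" "d \<in> D" "S c = i" "S d = Suc i" by (metis imageE)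
  \<comment> \<open>\<open>S \<noteq> T\<close> excludes the branch fixing \<open>S\<close>, and
    \<open>Some\<close> excludes the zero branch, so only the switch is left.\<close>
  have "fst d < fst c" "T = swap (S c) S"
    using pi \<open>S \<noteq> T\<close> row_of_entry[OF S cd(1)] row_of_entry[OF S cd(2)] cd
    by (auto simp: hecke_pi_def swap_def split: if_splits)
  then show ?thesis using that[OF S T cd(1,2)] cd by simp
qed

text \<open>First-column entries increase upwards, so \<open>c\<close> and \<open>d\<close> are not
  both in that column and the switch yields a tableau.\<close>

lemma hecke_stepI:
  assumes S: "S \<in> SIT \<alpha> \<beta>" and cd: "c \<in> D" "d \<in> D" "S d = Suc (S c)" "fst d < fst c"
  shows "(S, swap (S c) S) \<in> hecke_step \<alpha> \<beta>"
proof -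
  have kN: "1 \<le> S c" "S c + 1 \<le> N"
    using SIT_bij[OF S] cd by (metis Suc_eq_plus1 atLeastAtMost_iff bij_betwE)+
  have "\<not> (snd c = 1 \<and> snd d = 1)" using SIT_col[OF S cd(2,1)] cd by auto
  then have "swap (S c) S \<in> SIT \<alpha> \<beta>" using swap_in_SIT[OF S cd(1-3)] cd(4) by simp
  moreover have "swap (S c) S \<noteq> S"
    using swap_apply[OF cd(1), of "S c" S] by auto
  moreover have "hecke_pi \<alpha> \<beta> (S c) S = Some (swap (S c) S)"
    using row_of_entry[OF S cd(1)] row_of_entry[OF S cd(2)] cd
    by (simp add: hecke_pi_def swap_def)
  ultimately show ?thesis using S kN by (auto simp: hecke_step_def)
qed

lemma hecke_step_inv:
  assumes "(S, T) \<in> hecke_step \<alpha> \<beta>"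
  shows "tab_inv \<alpha> \<beta> T = Suc (tab_inv \<alpha> \<beta> S)"
proof -
  obtain c d where S: "S \<in> SIT \<alpha> \<beta>" and cd: "c \<in> D" "d \<in> D" "S d = Suc (S c)" "fst d < fst c"
    and T: "T = swap (S c) S" using assms by (rule hecke_stepE)
  let ?I = "\<lambda>T. {(x, y) \<in> D \<times> D. read_before x y \<and> T y < T x}"
  have iff: "T y < T x \<longleftrightarrow> S y < S x \<or> (x, y) = (c, d)"
    if xy: "x \<in> D" "y \<in> D" "read_before x y" for x y
  proof -
    \<comment> \<open>The reverse case would mean \<open>y = c\<close> and \<open>x = d\<close>, but
      \<open>d\<close> lies below \<open>c\<close> and is not read first.\<close>
    have "\<not> (S y = S c \<and> S x = Suc (S c))"
      using SIT_inj[OF S, of y c] SIT_inj[OF S, of x d] xy cd by (auto simp: read_before_def)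
    moreover have "S y = Suc (S c) \<and> S x = S c \<longleftrightarrow> (x, y) = (c, d)"
      using SIT_inj[OF S, of x c] SIT_inj[OF S, of y d] xy cd by auto
    ultimately show ?thesis
      using xy by (auto simp: T swap_apply transpose_Suc_less_iff)
  qed
  have "read_before c d" using cd by (simp add: read_before_def)
  then have "?I T = insert (c, d) (?I S)" using iff cd by auto
  moreover have "finite (?I S)"
    by (rule finite_subset[of _ "D \<times> D"]) (auto simp: finite_skew_diagram)
  moreover have "(c, d) \<notin> ?I S" using cd by auto
  ultimately show ?thesis by (simp add: tab_inv_card)
qed

lemma fill_along_in_SIT:
  assumes cells: "set cs = D" and sorted: "sorted_wrt Q cs" and asym: "asymp Q"
    and "\<And>c d. \<lbrakk>c \<in> D; d \<in> D; fst c = fst d; snd c < snd d\<rbrakk> \<Longrightarrow> Q c d"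
    and "\<And>c d. \<lbrakk>c \<in> D; d \<in> D; snd c = 1; snd d = 1; fst c < fst d\<rbrakk> \<Longrightarrow> Q c d"
  shows "fill_along cs \<in> SIT \<alpha> \<beta>"
proof (rule SIT_I)
  have dist: "distinct cs" by (rule sorted_wrt_asymp_distinct[OF sorted asym])
  then have "length cs = N" using card_D cells distinct_card by metis
  then show "bij_betw (fill_along cs) D {1..N}" using fill_along_bij[OF dist] cells by simp
qed (use assms fill_along_mono[OF sorted asym] in \<open>auto simp: fill_along_def\<close>)

text \<open>Consecutive entries link each entry to every larger one, so by transitivity
  \<open>T\<close> increases along \<open>Q\<close>, and \<open>monotone_bij_value\<close> gives
  \<open>T\<close> and the filling the same values. Used contrapositively: any other tableau has a
  consecutive pair violating \<open>Q\<close>.\<close>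

lemma SIT_eq_fill_along:
  assumes T: "T \<in> SIT \<alpha> \<beta>" and cells: "set cs = D" and sorted: "sorted_wrt Q cs"
    and asym: "asymp Q" and trans: "transp Q" and total: "totalp_on D Q"
    and consec: "\<And>c d. \<lbrakk>c \<in> D; d \<in> D; T d = Suc (T c)\<rbrakk> \<Longrightarrow> Q c d"
  shows "T = fill_along cs"
proof (rule extensionalityI)
  show "T \<in> extensional D" using T by (simp add: SIT_def)
  show "fill_along cs \<in> extensional D" using cells by (simp add: fill_along_def)
  have img: "T ` D = {1..N}" using SIT_bij[OF T] by (simp add: bij_betw_def)
  \<comment> \<open>Induction on the gap between the entries, through the cell \<open>e\<close> that
    holds the entry just before \<open>T d\<close>.\<close>
  have less_Q: "Q c d" if "c \<in> D" "d \<in> D" "T d = T c + Suc n" for c d n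
    using that
  proof (induction n arbitrary: d)
    case 0
    then show ?case using consec by simp
  next
    case (Suc n)
    have "T c \<in> {1..N}" "T d \<in> {1..N}" using img Suc.prems by blast+
    then have "T c + Suc n \<in> T ` D" using Suc.prems img by auto
    then obtain e where e: "e \<in> D" "T e = T c + Suc n" by auto
    have "Q c e" "Q e d" using Suc e consec by auto
    then show ?case by (rule transpD[OF trans])
  qed
  have mono: "T c < T d" if "c \<in> D" "d \<in> D" "Q c d" for c d
  proof (rule ccontr)
    assume "\<not> T c < T d"
    then consider "T c = T d" | n where "T c = T d + Suc n"
      by (metis add_Suc_right less_imp_Suc_add linorder_neqE_nat)
    then show False
    proof cases
      case 1
      then show ?thesis using SIT_inj[OF T that(1,2)] that(3) asym by (metis asympD)
    next
      case 2
      then show ?thesis using less_Q[OF that(2,1)] that(3) asym by (metis asympD)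
    qed
  qed
  have dist: "distinct cs" by (rule sorted_wrt_asymp_distinct[OF sorted asym])
  fix c assume c: "c \<in> D"
  have "T c = card {d \<in> D. d = c \<or> Q d c}"
    using SIT_bij[OF T] asym total mono c by (rule monotone_bij_value)
  also have "fill_along cs c = card {d \<in> D. d = c \<or> Q d c}"
    using fill_along_bij[OF dist] fill_along_mono[OF sorted asym] c
    unfolding cells by (intro monotone_bij_value[OF _ asym total]) auto
  then have "card {d \<in> D. d = c \<or> Q d c} = fill_along cs c" by simp
  finally show "T c = fill_along cs c" .
qed

section \<open>The extreme fillings \<open>S0\<close> and \<open>Srow\<close>\<close>

definition "S0_cells =
  map (\<lambda>i. (i, 1)) [length \<beta> + 1 ..< length \<alpha> + 1] @
  concat (map (\<lambda>i. filter (\<lambda>c. snd c \<noteq> 1) (skew_row \<alpha> \<beta> i)) (rev [1 ..< length \<alpha> + 1]))"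

lemma set_S0_cells: "set S0_cells = D"
proof -
  have "c \<in> set S0_cells \<longleftrightarrow> c \<in> D" for c
  proof (cases "snd c = 1")
    case True
    then show ?thesis using first_col[of "fst c"] by (cases c) (auto simp: S0_cells_def)
  next
    case False
    then show ?thesis by (cases c) (auto simp: S0_cells_def skew_diagram_Sigma set_skew_row)
  qed
  then show ?thesis by blast
qed

lemma sorted_S0_cells: "sorted_wrt col_first S0_cells"
proof -
  let ?row = "\<lambda>i. filter (\<lambda>c. snd c \<noteq> 1) (skew_row \<alpha> \<beta> i)"
  have "sorted_wrt (\<lambda>i i'. col_first (i, 1) (i', 1)) [length \<beta> + 1 ..< length \<alpha> + 1]"
    by (rule sorted_wrt_mono_rel[OF _ sorted_wrt_upt]) (auto simp: col_first_def)
  moreover have "sorted_wrt col_first (concat (map ?row (rev [1 ..< length \<alpha> + 1])))"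
  proof (rule sorted_wrt_concat_map)
    show "sorted_wrt (\<lambda>i i'. \<forall>c\<in>set (?row i). \<forall>d\<in>set (?row i'). col_first c d)
        (rev [1 ..< length \<alpha> + 1])"
      unfolding sorted_wrt_rev
      by (rule sorted_wrt_mono_rel[OF _ sorted_wrt_upt]) (auto simp: set_skew_row col_first_def)
    show "sorted_wrt col_first (?row i)" for i
      by (rule sorted_wrt_mono_rel[OF _ sorted_wrt_filter[OF skew_row_sorted]])
        (auto simp: col_first_def)
  qed
  ultimately show ?thesis
    unfolding S0_cells_def sorted_wrt_append sorted_wrt_map by (auto simp: col_first_def)
qed

lemma S0_fill: "S0 \<alpha> \<beta> = fill_along S0_cells"
  by (simp only: S0_def S0_cells_def)

lemma S0_in_SIT: "S0 \<alpha> \<beta> \<in> SIT \<alpha> \<beta>"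
  unfolding S0_fill
  by (rule fill_along_in_SIT[OF set_S0_cells sorted_S0_cells asymp_col_first])
    (auto simp: col_first_def dest: col_pos)

text \<open>Totality of \<open>col_first\<close> turns monotonicity of the filling into an
  equivalence.\<close>

lemma S0_less_iff:
  assumes "c \<in> D" "d \<in> D"
  shows "S0 \<alpha> \<beta> c < S0 \<alpha> \<beta> d \<longleftrightarrow> col_first c d"
proof -
  have mono: "S0 \<alpha> \<beta> c < S0 \<alpha> \<beta> d" if "col_first c d" "c \<in> D" "d \<in> D" for c d
    using fill_along_mono[OF sorted_S0_cells asymp_col_first] that by (simp add: set_S0_cells S0_fill)
  show ?thesis
    using mono[of c d] mono[of d c] assms totalp_col_first[of D]
    by (metis less_asym less_irrefl totalp_onD)
qed

definition "Srow_cells = concat (map (skew_row \<alpha> \<beta>) [1 ..< length \<alpha> + 1])"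

lemma set_Srow_cells: "set Srow_cells = D"
  by (auto simp: Srow_cells_def skew_diagram_Sigma set_skew_row)

lemma sorted_Srow_cells: "sorted_wrt (\<lambda>c d. read_before d c) Srow_cells"
  unfolding Srow_cells_def
proof (rule sorted_wrt_concat_map)
  show "sorted_wrt (\<lambda>i i'. \<forall>c\<in>set (skew_row \<alpha> \<beta> i). \<forall>d\<in>set (skew_row \<alpha> \<beta> i'). read_before d c)
      [1 ..< length \<alpha> + 1]"
    by (rule sorted_wrt_mono_rel[OF _ sorted_wrt_upt]) (auto simp: set_skew_row read_before_def)
  show "sorted_wrt (\<lambda>c d. read_before d c) (skew_row \<alpha> \<beta> i)" for i
    by (rule sorted_wrt_mono_rel[OF _ skew_row_sorted]) (auto simp: read_before_def)
qed

lemma Srow_fill: "Srow \<alpha> \<beta> = fill_along Srow_cells"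
  by (simp only: Srow_def Srow_cells_def)

lemma Srow_in_SIT: "Srow \<alpha> \<beta> \<in> SIT \<alpha> \<beta>"
  unfolding Srow_fill
  by (rule fill_along_in_SIT[OF set_Srow_cells sorted_Srow_cells asymp_read_before_conv])
    (auto simp: read_before_def)

section \<open>Sources and sinks of the action\<close>

text \<open>If \<open>k\<close> lies outside the first column and \<open>k + 1\<close> inside it, then \<open>k + 1\<close> is strictly above
  \<open>k\<close>: otherwise the row of \<open>k\<close> also starts in the first column, with an entry below \<open>k\<close> and at
  least \<open>k + 1\<close>.\<close>

lemma not_col_first_consecutive:
  assumes T: "T \<in> SIT \<alpha> \<beta>" and cd: "c \<in> D" "d \<in> D" "T d = Suc (T c)"
    and nq: "\<not> col_first c d"
  shows "fst c < fst d \<and> \<not> (snd c = 1 \<and> snd d = 1)"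
proof -
  have ne: "c \<noteq> d" using cd by auto
  have row: "\<not> (fst c = fst d \<and> snd d < snd c)" using SIT_row[OF T cd(2,1)] cd(3) by auto
  have "fst c < fst d" if c1: "snd c \<noteq> 1"
  proof (cases "snd d = 1")
    case True
    show ?thesis
    proof (rule ccontr)
      assume le: "\<not> fst c < fst d"
      let ?e = "(fst c, 1)"
      have "(fst d, 1) \<in> D" using cd(2) True by (metis prod.collapse)
      moreover have "fst c \<le> length \<alpha>" using cd(1) by (auto simp: skew_diagram_Sigma)
      ultimately have e: "?e \<in> D" using le unfolding first_col by simp
      have "T ?e < T c" using SIT_row[OF T e cd(1)] col_pos[OF cd(1)] c1 by simp
      moreover have "T d \<le> T ?e"
        using SIT_col[OF T cd(2) e True] le True by (cases d) (auto simp: not_less le_less)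
      ultimately show False using cd(3) by simp
    qed
  next
    case False
    then show ?thesis using nq c1 row ne by (auto simp: col_first_def prod_eq_iff)
  qed
  \<comment> \<open>If \<open>c\<close> were in the first column, the failure of
    \<open>col_first c d\<close> would put \<open>d\<close> there too, strictly lower, and so with a
    smaller entry.\<close>
  moreover have "snd c \<noteq> 1"
    using nq SIT_col[OF T cd(2,1)] cd(3) ne by (force simp: col_first_def prod_eq_iff)
  ultimately show ?thesis by simp
qed

lemma step_into_SIT:
  assumes T: "T \<in> SIT \<alpha> \<beta>" and ne: "T \<noteq> S0 \<alpha> \<beta>"
  shows "\<exists>S. (S, T) \<in> hecke_step \<alpha> \<beta>"
proof -
  obtain c d where cd: "c \<in> D" "d \<in> D" "T d = Suc (T c)" and "\<not> col_first c d"
    using SIT_eq_fill_along[OF T set_S0_cells sorted_S0_cells asymp_col_first transp_col_first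
        totalp_col_first] ne S0_fill by metis
  then have lt: "fst c < fst d" and col: "\<not> (snd c = 1 \<and> snd d = 1)"
    using not_col_first_consecutive[OF T] by auto
  let ?S = "swap (T c) T"
  have S: "?S \<in> SIT \<alpha> \<beta>" using swap_in_SIT[OF T cd] lt col by simp
  \<comment> \<open>In \<open>?S\<close> the smaller entry sits in \<open>d\<close>, the higher of
    the two cells, so the action switches the pair back and produces \<open>T\<close>.\<close>
  have "?S d = T c" "?S c = Suc (T c)" using cd by (simp_all add: swap_apply)
  then have "(?S, swap (T c) ?S) \<in> hecke_step \<alpha> \<beta>"
    using hecke_stepI[OF S cd(2,1)] lt by simp
  then show ?thesis using swap_swap[OF T] by auto
qed

text \<open>Rows increase, so a consecutive pair against the order of \<open>Srow\<close> has its
  larger entry in a strictly lower row, which is where the action switches.\<close>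

lemma step_from_SIT:
  assumes T: "T \<in> SIT \<alpha> \<beta>" and ne: "T \<noteq> Srow \<alpha> \<beta>"
  shows "\<exists>S. (T, S) \<in> hecke_step \<alpha> \<beta>"
proof -
  obtain c d where cd: "c \<in> D" "d \<in> D" "T d = Suc (T c)" and nr: "\<not> read_before d c"
    using SIT_eq_fill_along[OF T set_Srow_cells sorted_Srow_cells asymp_read_before_conv
        transp_read_before_conv totalp_read_before_conv] ne Srow_fill by metis
  have "\<not> (fst c = fst d \<and> snd d < snd c)" using SIT_row[OF T cd(2,1)] cd(3) by auto
  moreover have "c \<noteq> d" using cd by auto
  ultimately have "fst d < fst c" using nr by (auto simp: read_before_def prod_eq_iff)
  then show ?thesis using hecke_stepI[OF T cd] by blast
qed

section \<open>Inversion numbers of \<open>Srow\<close> and \<open>S0\<close>\<close>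

lemma inv_Srow: "tab_inv \<alpha> \<beta> (Srow \<alpha> \<beta>) = N choose 2"
proof -
  have bij: "bij_betw (Srow \<alpha> \<beta>) D {1..N}" by (rule SIT_bij[OF Srow_in_SIT])
  have mono: "Srow \<alpha> \<beta> d < Srow \<alpha> \<beta> c" if "c \<in> D" "d \<in> D" "read_before c d" for c d
    using fill_along_mono[OF sorted_Srow_cells asymp_read_before_conv] that
    by (simp add: set_Srow_cells Srow_fill)
  \<comment> \<open>All cells read after \<open>c\<close> carry smaller entries; the entry of
    \<open>c\<close> counts them together with \<open>c\<close> itself.\<close>
  have "card {d \<in> D. read_before c d \<and> Srow \<alpha> \<beta> d < Srow \<alpha> \<beta> c} = Srow \<alpha> \<beta> c - 1"
    if c: "c \<in> D" for c
  proof -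
    have "{d \<in> D. d = c \<or> read_before c d} =
        insert c {d \<in> D. read_before c d \<and> Srow \<alpha> \<beta> d < Srow \<alpha> \<beta> c}"
      using c mono[OF c] by blast
    moreover have "Srow \<alpha> \<beta> c = card {d \<in> D. d = c \<or> read_before c d}"
      using bij asymp_read_before_conv totalp_read_before_conv mono c
      by (rule monotone_bij_value)
    ultimately have "Srow \<alpha> \<beta> c =
        card (insert c {d \<in> D. read_before c d \<and> Srow \<alpha> \<beta> d < Srow \<alpha> \<beta> c})"
      by argo
    also have "\<dots> = Suc (card {d \<in> D. read_before c d \<and> Srow \<alpha> \<beta> d < Srow \<alpha> \<beta> c})"
      by (simp add: finite_skew_diagram)
    finally show ?thesis by linarith
  qed
  then have "tab_inv \<alpha> \<beta> (Srow \<alpha> \<beta>) = (\<Sum>c\<in>D. Srow \<alpha> \<beta> c - 1)"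
    by (simp add: tab_inv_sum)
  also have "\<dots> = (\<Sum>k = 1..N. k - 1)"
    using bij by (rule sum.reindex_bij_betw)
  also have "\<dots> = N choose 2" using sum_shifted_row[where b = 0 and a = N and k = 0] by simp
  finally show ?thesis .
qed

text \<open>In a row \<open>i\<close> above \<open>\<beta>\<close>, adding
  \<open>(i - length \<beta> - 1) choose 2\<close> completes the contribution to a single binomial
  by \<open>choose_two_add\<close>; the added terms sum to the \<open>choose 3\<close> term.\<close>

lemma inv_S0:
  "tab_inv \<alpha> \<beta> (S0 \<alpha> \<beta>) + ((length \<alpha> - length \<beta>) choose 3) =
     (\<Sum>i = 1..length \<beta>. (part \<alpha> i - part \<beta> i) choose 2) +
     (\<Sum>i = length \<beta> + 1..length \<alpha>. (part \<alpha> i + i - length \<beta> - 1) choose 2)"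
proof -
  \<comment> \<open>Truncated subtraction makes \<open>?k i\<close> zero for
    \<open>i \<le> length \<beta>\<close>, so one formula serves both kinds of rows.\<close>
  let ?a = "\<lambda>i. part \<alpha> i" and ?b = "\<lambda>i. part \<beta> i" and ?k = "\<lambda>i. i - (length \<beta> + 1)"
  let ?g = "\<lambda>i. ((?a i - ?b i) choose 2) + (?a i - ?b i) * ?k i"
  have le: "length \<beta> \<le> length \<alpha>" using inner_subset by (simp add: comp_subset_def)
  have count: "card {d \<in> D. read_before (i, j) d \<and> S0 \<alpha> \<beta> d < S0 \<alpha> \<beta> (i, j)} = (j - 1 - ?b i) + ?k i"
    if ij: "(i, j) \<in> D" for i j
  proof -
    have iD: "i \<le> length \<alpha>" using ij by (auto simp: skew_diagram_Sigma)
    have "{d \<in> D. read_before (i, j) d \<and> S0 \<alpha> \<beta> d < S0 \<alpha> \<beta> (i, j)} =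
        {d \<in> D. read_before (i, j) d \<and> col_first d (i, j)}"
      using S0_less_iff ij by blast
    also have "\<dots> = {i} \<times> {?b i + 1..<j} \<union> {length \<beta> + 1..<i} \<times> {1}"
    proof (intro set_eqI)
      fix d :: "nat \<times> nat"
      have row: "(i, n) \<in> D \<longleftrightarrow> ?b i < n" if "n < j" for n
        using ij that by (simp add: mem_skew_diagram)
      have col: "(m, 1) \<in> D \<longleftrightarrow> length \<beta> < m" if "m < i" for m
        using iD that unfolding first_col by simp
      obtain m n where d: "d = (m, n)" by fastforce
      \<comment> \<open>A cell of a lower row outside the first column is filled after
        \<open>(i, j)\<close>, so only cells to the left and first-column cells below
        remain.\<close>
      have "read_before (i, j) d \<and> col_first d (i, j) \<longleftrightarrow> m = i \<and> n < j \<or> m < i \<and> n = 1"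
        if "d \<in> D"
        using col_pos[OF ij] col_pos[OF that]
        by (auto simp: d read_before_def col_first_def)
      then show "d \<in> {d \<in> D. read_before (i, j) d \<and> col_first d (i, j)} \<longleftrightarrow>
          d \<in> {i} \<times> {?b i + 1..<j} \<union> {length \<beta> + 1..<i} \<times> {1}"
        using row[of n] col[of m] by (auto simp: d)
    qed
    finally show ?thesis
      by (simp add: card_Un_disjoint disjoint_iff card_cartesian_product)
  qed
  have "tab_inv \<alpha> \<beta> (S0 \<alpha> \<beta>) = (\<Sum>(i, j)\<in>D. (j - 1 - ?b i) + ?k i)"
    unfolding tab_inv_sum by (intro sum.cong) (auto simp: count)
  also have "\<dots> = (\<Sum>i = 1..length \<alpha>. \<Sum>j = ?b i + 1..?a i. (j - 1 - ?b i) + ?k i)"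
    unfolding skew_diagram_Sigma by (subst sum.Sigma) auto
  also have "\<dots> = (\<Sum>i = 1..length \<alpha>. ?g i)"
    by (simp only: sum_shifted_row)
  also have "\<dots> = (\<Sum>i = 1..length \<beta>. ?g i) + (\<Sum>i = length \<beta> + 1..length \<alpha>. ?g i)"
    using sum.ub_add_nat[of 1 "length \<beta>" ?g "length \<alpha> - length \<beta>"] le by simp
  finally have "tab_inv \<alpha> \<beta> (S0 \<alpha> \<beta>) =
    (\<Sum>i = 1..length \<beta>. ?g i) + (\<Sum>i = length \<beta> + 1..length \<alpha>. ?g i)" .
  moreover have "(\<Sum>i = 1..length \<beta>. ?g i) = (\<Sum>i = 1..length \<beta>. (?a i - ?b i) choose 2)"
    by (intro sum.cong) auto
  moreover have "(\<Sum>i = length \<beta> + 1..length \<alpha>. ?g i) + ((length \<alpha> - length \<beta>) choose 3) =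
      (\<Sum>i = length \<beta> + 1..length \<alpha>. (?a i + i - length \<beta> - 1) choose 2)"
    \<comment> \<open>The \<open>choose 3\<close> term is expanded into a sum, and the identity is
      then checked row by row.\<close>
    unfolding sum_shifted_choose_two[symmetric] sum.distrib[symmetric]
  proof (intro sum.cong refl)
    fix i assume i: "i \<in> {length \<beta> + 1..length \<alpha>}"
    then have "?a i + i - length \<beta> - 1 = ?a i + (i - length \<beta> - 1)" "?b i = 0"
      by (auto simp: part_def)
    then show "?g i + ((i - length \<beta> - 1) choose 2) = (?a i + i - length \<beta> - 1) choose 2"
      by (simp add: choose_two_add)
  qed
  ultimately show ?thesis by simp
qed

section \<open>Gradedness and rank of the Hecke poset\<close>

sublocale unit_step_poset "SIT \<alpha> \<beta>" "hecke_step \<alpha> \<beta>" "tab_inv \<alpha> \<beta>" "S0 \<alpha> \<beta>" "Srow \<alpha> \<beta>"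
  by unfold_locales
    (use finite_SIT S0_in_SIT Srow_in_SIT step_into_SIT step_from_SIT hecke_step_inv
      in \<open>auto simp: hecke_step_def\<close>)

lemma hecke_order_eq: "hecke_order \<alpha> \<beta> = step_order"
  by (simp add: hecke_order_def step_order_def)

text \<open>The rank is a difference of naturals; this inequality ensures that nothing is truncated
  on passing to integers.\<close>

lemma inv_S0_le: "tab_inv \<alpha> \<beta> (S0 \<alpha> \<beta>) \<le> tab_inv \<alpha> \<beta> (Srow \<alpha> \<beta>)"
  using height_mono[OF bottom_le[OF Srow_in_SIT]] by auto

end

theorem proposition6p15:
  fixes \<alpha> \<beta> :: "nat list"
  assumes "composition \<alpha>" and "composition \<beta>" and "comp_subset \<beta> \<alpha>"
  shows "graded_poset (SIT \<alpha> \<beta>) (hecke_order \<alpha> \<beta>) \<and>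
    is_rank_function (SIT \<alpha> \<beta>) (hecke_order \<alpha> \<beta>)
      (\<lambda>T. int (tab_inv \<alpha> \<beta> T) - int (tab_inv \<alpha> \<beta> (S0 \<alpha> \<beta>))) \<and>
    tab_inv \<alpha> \<beta> (Srow \<alpha> \<beta>) = (sum_list \<alpha> - sum_list \<beta>) choose 2 \<and>
    int (tab_inv \<alpha> \<beta> (S0 \<alpha> \<beta>)) =
      (\<Sum>i = 1..length \<beta>. int ((part \<alpha> i - part \<beta> i) choose 2))
      + (\<Sum>i = length \<beta> + 1..length \<alpha>. int ((part \<alpha> i + i - length \<beta> - 1) choose 2))
      - int ((length \<alpha> - length \<beta>) choose 3) \<and>
    int (poset_rank (hecke_order \<alpha> \<beta>)) =
      int ((sum_list \<alpha> - sum_list \<beta>) choose 2)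
      - (\<Sum>i = 1..length \<beta>. int ((part \<alpha> i - part \<beta> i) choose 2))
      - (\<Sum>i = length \<beta> + 1..length \<alpha>. int ((part \<alpha> i + i - length \<beta> - 1) choose 2))
      + int ((length \<alpha> - length \<beta>) choose 3)"
proof -
  interpret skew_shape \<alpha> \<beta> using assms by unfold_locales
  have Srow: "tab_inv \<alpha> \<beta> (Srow \<alpha> \<beta>) = (sum_list \<alpha> - sum_list \<beta>) choose 2"
    using inv_Srow by (simp add: skew_size_def)
  have S0: "int (tab_inv \<alpha> \<beta> (S0 \<alpha> \<beta>)) =
      (\<Sum>i = 1..length \<beta>. int ((part \<alpha> i - part \<beta> i) choose 2))
      + (\<Sum>i = length \<beta> + 1..length \<alpha>. int ((part \<alpha> i + i - length \<beta> - 1) choose 2))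
      - int ((length \<alpha> - length \<beta>) choose 3)"
    using arg_cong[OF inv_S0, of int] by simp
  have "int (poset_rank (hecke_order \<alpha> \<beta>)) =
      int (tab_inv \<alpha> \<beta> (Srow \<alpha> \<beta>)) - int (tab_inv \<alpha> \<beta> (S0 \<alpha> \<beta>))"
    using rank inv_S0_le by (simp add: hecke_order_eq)
  then show ?thesis
    using graded rank_function Srow S0 by (simp add: hecke_order_eq)
qed

end
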